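(* For every $\beta\in\mathbb{R}^{mK}$, the Hessian $H=\nabla^2\mathcal{L}(\beta)$ satisfies $$\lambda_{\min}^{+}(H)\ \ge\ \frac{m}{\eta n}\min_{k\in[K]}(w_kp_k^2),\qquad \lambda_{\max}(H)\ \le\ \big(\max_{k\in[K]}w_k\big)\Big(\frac{1}{2\eta}+\frac1\tau\Big),$$ where $p_k=\min_{j\in[m]}[P_k]_{i^\star j}$ for an index $i^\star\in\arg\max_{i\in[n]}v_i$.
   Context: $\lambda_{\min}^+(\cdot)$ and $\lambda_{\max}(\cdot)$ denote the smallest strictly positive and the largest eigenvalue of a real symmetric matrix (a lower bound on $\lambda^+_{\min}$ is read as vacuous if there is no positive eigenvalue). Let $n,m,K\ge 1$ be integers, $[K]=\{1,\dots,K\}$, $\eta,\tau>0$, and let $\Delta_d=\{x\in\mathbb{R}_+^d:\sum_i x_i=1\}$. Let $\mu_k\in\Delta_m$ ($k\in[K]$), $C_k\in\mathbb{R}_+^{n\times m}$, $w_k>0$ with $\sum_{k=1}^K w_k=1$, and $\pi\in\Delta_n$. For $\beta=(\beta_1^\top,\dots,\beta_K^\top)^\top\in\mathbb{R}^{mK}$ with $\beta_k\in\mathbb{R}^m$ define: - $[\alpha_k(\beta_k)]_i=-\eta\log\big(\sum_{j=1}^m[\mu_k]_j\exp(([\beta_k]_j-[C_k]_{ij})/\eta)\big)$ for $i\in[n]$, and $\Phi(\beta)=\sum_{k=1}^K w_k\alpha_k(\beta_k)\in\mathbb{R}^n$; - $\mathcal{L}(\beta)=-\sum_{k=1}^K w_k\langle\beta_k,\mu_k\rangle+\tau\log\big(\sum_{i=1}^n\pi_i\exp(-[\Phi(\beta)]_i/\tau)\big)$;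 - $v=v(\beta)\in\Delta_n$, $v_i=\pi_i\exp(-[\Phi(\beta)]_i/\tau)\big/\sum_{l=1}^n\pi_l\exp(-[\Phi(\beta)]_l/\tau)$; - $P_k=P_k(\beta_k)\in\mathbb{R}^{n\times m}$, $[P_k]_{ij}=\dfrac{[\mu_k]_j\exp(([\beta_k]_j-[C_k]_{ij})/\eta)}{\sum_{l=1}^m[\mu_k]_l\exp(([\beta_k]_l-[C_k]_{il})/\eta)}$ (row-stochastic), and $\gamma_k=P_k^\top v$. The Hessian $H=\nabla^2\mathcal{L}(\beta)$ has $m\times m$ blocks $$H_{kk}=\tfrac{w_k^2}{\tau}\big(P_k^\top\mathrm{diag}(v)P_k-\gamma_k\gamma_k^\top\big)+\tfrac{w_k}{\eta}\big(\mathrm{diag}(\gamma_k)-P_k^\top\mathrm{diag}(v)P_k\big),$$ $$H_{kr}=\tfrac{w_kw_r}{\tau}\big(P_k^\top\mathrm{diag}(v)P_r-\gamma_k\gamma_r^\top\big)\quad(k\ne r).$$ *)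

theory Defs
  imports "HOL-Analysis.Analysis"
begin

text \<open>
  The finite index types \<open>'n\<close>, \<open>'m\<close>, \<open>'k\<close> play the roles of \<open>[n]\<close>, \<open>[m]\<close>, \<open>[K]\<close>.
  The stacked vector \<open>\<beta> = (\<beta>\<^sub>1, \<dots>, \<beta>\<^sub>K)\<close> of length \<open>mK\<close> is an element of \<open>real ^ ('k \<times> 'm)\<close>,
  whose entry at \<open>(k, j)\<close> is the \<open>j\<close>-th entry of \<open>\<beta>\<^sub>k\<close>. An \<open>n \<times> m\<close> matrix has type \<open>real ^ 'm ^ 'n\<close>,
  so that \<open>C $ i $ j\<close> is its entry in row \<open>i\<close> and column \<open>j\<close>.
\<close>

definition prob_simplex :: "(real ^ 'd) set" where
  "prob_simplex = {x. (\<forall>i. 0 \<le> x $ i) \<and> (\<Sum>i\<in>UNIV. x $ i) = 1}"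

definition blk :: "real ^ ('k::finite \<times> 'm::finite) \<Rightarrow> 'k \<Rightarrow> real ^ 'm" where
  "blk \<beta> k = (\<chi> j. \<beta> $ (k, j))"


definition alpha ::
  "real \<Rightarrow> real ^ 'm \<Rightarrow> real ^ 'm ^ 'n \<Rightarrow> real ^ 'm \<Rightarrow> real ^ 'n" where
  "alpha \<eta> \<mu>k Ck \<beta>k =
     (\<chi> i. - \<eta> * ln (\<Sum>j\<in>UNIV. \<mu>k $ j * exp ((\<beta>k $ j - Ck $ i $ j) / \<eta>)))"

definition Phi ::
  "real \<Rightarrow> ('k \<Rightarrow> real) \<Rightarrow> ('k \<Rightarrow> real ^ 'm) \<Rightarrow> ('k \<Rightarrow> real ^ 'm ^ 'n) \<Rightarrow>
   real ^ ('k::finite \<times> 'm::finite) \<Rightarrow> real ^ 'n" where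
  "Phi \<eta> w \<mu> C \<beta> = (\<Sum>k\<in>UNIV. w k *\<^sub>R alpha \<eta> (\<mu> k) (C k) (blk \<beta> k))"

definition objective ::
  "real \<Rightarrow> real \<Rightarrow> ('k \<Rightarrow> real) \<Rightarrow> ('k \<Rightarrow> real ^ 'm) \<Rightarrow> ('k \<Rightarrow> real ^ 'm ^ 'n) \<Rightarrow>
   real ^ 'n \<Rightarrow> real ^ ('k::finite \<times> 'm::finite) \<Rightarrow> real" where
  "objective \<eta> \<tau> w \<mu> C \<pi> \<beta> =
     - (\<Sum>k\<in>UNIV. w k * (blk \<beta> k \<bullet> \<mu> k))
     + \<tau> * ln (\<Sum>i\<in>UNIV. \<pi> $ i * exp (- Phi \<eta> w \<mu> C \<beta> $ i / \<tau>))"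

definition vvec ::
  "real \<Rightarrow> real \<Rightarrow> ('k \<Rightarrow> real) \<Rightarrow> ('k \<Rightarrow> real ^ 'm) \<Rightarrow> ('k \<Rightarrow> real ^ 'm ^ 'n) \<Rightarrow>
   real ^ 'n \<Rightarrow> real ^ ('k::finite \<times> 'm::finite) \<Rightarrow> real ^ 'n" where
  "vvec \<eta> \<tau> w \<mu> C \<pi> \<beta> =
     (\<chi> i. \<pi> $ i * exp (- Phi \<eta> w \<mu> C \<beta> $ i / \<tau>)
           / (\<Sum>l\<in>UNIV. \<pi> $ l * exp (- Phi \<eta> w \<mu> C \<beta> $ l / \<tau>)))"

definition Pmat ::
  "real \<Rightarrow> real ^ 'm \<Rightarrow> real ^ 'm ^ 'n \<Rightarrow> real ^ 'm \<Rightarrow> real ^ 'm ^ 'n" where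
  "Pmat \<eta> \<mu>k Ck \<beta>k =
     (\<chi> i j. \<mu>k $ j * exp ((\<beta>k $ j - Ck $ i $ j) / \<eta>)
             / (\<Sum>l\<in>UNIV. \<mu>k $ l * exp ((\<beta>k $ l - Ck $ i $ l) / \<eta>)))"


definition gradient :: "(real ^ 'd \<Rightarrow> real) \<Rightarrow> real ^ 'd \<Rightarrow> real ^ 'd" where
  "gradient f x = (\<chi> i. frechet_derivative f (at x) (axis i 1))"

definition hessian :: "(real ^ 'd \<Rightarrow> real) \<Rightarrow> real ^ 'd \<Rightarrow> real ^ 'd ^ 'd" where
  "hessian f x = jacobian (gradient f) (at x)"

text \<open>
  Only real eigenvalues are collected, which for a real symmetric matrix are all of them.
  \<open>lambda_min_pos A\<close> is unspecified if \<open>A\<close> has no positive eigenvalue.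
\<close>

definition eigenvalues :: "real ^ 'd ^ 'd \<Rightarrow> real set" where
  "eigenvalues A = {c. \<exists>x. x \<noteq> 0 \<and> A *v x = c *\<^sub>R x}"

definition lambda_max :: "real ^ 'd ^ 'd \<Rightarrow> real" where
  "lambda_max A = Max (eigenvalues A)"

definition lambda_min_pos :: "real ^ 'd ^ 'd \<Rightarrow> real" where
  "lambda_min_pos A = Min {c \<in> eigenvalues A. 0 < c}"

end

theory Submission
  imports Defs
begin

text \<open>
  The Hessian is a sum of covariances. Both \<open>v\<close> and every row of every \<open>P\<^sub>k\<close> are softmax
  distributions, and differentiating a softmax in a direction multiplies its entries by the
  centred direction. Differentiating \<open>\<L>\<close> twice therefore gives, with
  \<open>g\<^sub>i(x) = \<Sum>\<^sub>k w\<^sub>k (P\<^sub>k x\<^sub>k)\<^sub>i\<close>,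
  \<open>y\<^sup>T H x = Cov\<^sub>v(g(x), g(y)) / \<tau> + \<Sum>\<^sub>k (w\<^sub>k / \<eta>) \<Sum>\<^sub>i v\<^sub>i Cov(x\<^sub>k, y\<^sub>k)\<close>,
  where the inner covariance is with respect to row \<open>i\<close> of \<open>P\<^sub>k\<close>
  (lemma \<open>inner_hessian_mult\<close>). All that follows is read off this formula.

  For the upper bound, a variance under a probability vector is at most half the squared
  Euclidean norm (lemma \<open>cov_self_le_half\<close>), which bounds the second part by
  \<open>max w / (2\<eta>)\<close>. The first variance is at most a second moment, and since the \<open>w\<^sub>k\<close> and the
  rows of \<open>P\<^sub>k\<close> are themselves probability vectors, two uses of Jensen's inequality bound it
  by \<open>\<Sum>\<^sub>k w\<^sub>k \<parallel>x\<^sub>k\<parallel>\<^sup>2\<close> (lemma \<open>hess_form_le\<close>).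

  For the lower bound, covariances vanish against constants, so \<open>H\<close> annihilates every vector
  that is constant on each block. As \<open>H\<close> is symmetric, an eigenvector of a positive
  eigenvalue is orthogonal to these, that is, each of its blocks sums to zero. On such blocks a
  variance under weights that are all at least \<open>q\<close> is at least \<open>m q\<^sup>2 \<parallel>x\<^sub>k\<parallel>\<^sup>2\<close>
  (lemma \<open>cov_self_ge_if_sum_zero\<close>). Keeping only the row \<open>i\<^sup>\<star>\<close>, whose weight
  \<open>v\<close> is at least \<open>1/n\<close> because it is the largest, gives the bound
  (lemma \<open>hess_form_ge\<close>).
\<close>

section \<open>Covariance under a finite probability vector\<close>

abbreviation weights :: "('d::finite \<Rightarrow> real) \<Rightarrow> bool" where
  "weights p \<equiv> (\<forall>i. 0 \<le> p i) \<and> (\<Sum>i\<in>UNIV. p i) = 1"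

lemma weighted_average_le:
  assumes "weights p" and "\<And>i. f i \<le> b"
  shows "(\<Sum>i\<in>UNIV. p i * f i) \<le> b"
proof -
  have "(\<Sum>i\<in>UNIV. p i * f i) \<le> (\<Sum>i\<in>UNIV. p i * b)"
    using assms by (intro sum_mono mult_left_mono) auto
  then show ?thesis
    using assms by (simp flip: sum_distrib_right)
qed

definition cov :: "('d::finite \<Rightarrow> real) \<Rightarrow> ('d \<Rightarrow> real) \<Rightarrow> ('d \<Rightarrow> real) \<Rightarrow> real" where
  "cov p x y = (\<Sum>i\<in>UNIV. p i * x i * y i) - (\<Sum>i\<in>UNIV. p i * x i) * (\<Sum>i\<in>UNIV. p i * y i)"

lemma cov_commute: "cov p x y = cov p y x"
  by (simp add: cov_def mult_ac)

lemma cov_const_right: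
  assumes "(\<Sum>i\<in>UNIV. p i) = 1"
  shows "cov p x (\<lambda>_. c) = 0"
  using assms by (simp add: cov_def flip: sum_distrib_right)

text \<open>
  Centring one argument suffices. It is in this one-sided form that covariances arise from the
  derivative of a softmax.
\<close>

lemma cov_eq_centred:
  "cov p x y = (\<Sum>i\<in>UNIV. p i * (x i - (\<Sum>l\<in>UNIV. p l * x l)) * y i)"
  by (simp add: cov_def algebra_simps sum_subtractf sum_distrib_left)

text \<open>
  Both bounds on the variance come from this form: the weights multiply squares, so nonnegativity
  of the weights allows each pair of indices to be estimated separately.
\<close>

lemma cov_eq_pairwise_differences:
  assumes "(\<Sum>i\<in>UNIV. p i) = 1"
  shows "cov p x x = (\<Sum>i\<in>UNIV. \<Sum>j\<in>UNIV. p i * p j * (x i - x j)\<^sup>2) / 2"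
proof -
  have "(\<Sum>i\<in>UNIV. \<Sum>j\<in>UNIV. p i * p j * (x i - x j)\<^sup>2)
      = (\<Sum>i\<in>UNIV. \<Sum>j\<in>UNIV. p i * x i * x i * p j + p i * (p j * x j * x j)
           - 2 * ((p i * x i) * (p j * x j)))"
    by (intro sum.cong refl) (simp add: power2_eq_square algebra_simps)
  also have "\<dots> = 2 * (\<Sum>i\<in>UNIV. p i * x i * x i) - 2 * (\<Sum>i\<in>UNIV. p i * x i)\<^sup>2"
    using assms by (simp add: sum.distrib sum_subtractf power2_eq_square
        flip: sum_distrib_left sum_distrib_right)
  finally show ?thesis
    by (simp add: cov_def power2_eq_square)
qed

lemma cov_self_nonneg:
  assumes "weights p"
  shows "0 \<le> cov p x x"
  using assms by (subst cov_eq_pairwise_differences) (auto intro!: sum_nonneg divide_nonneg_pos)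

lemma square_mean_le_mean_square:
  assumes "weights p"
  shows "(\<Sum>i\<in>UNIV. p i * x i)\<^sup>2 \<le> (\<Sum>i\<in>UNIV. p i * (x i)\<^sup>2)"
  using cov_self_nonneg[OF assms, of x] by (simp add: cov_def power2_eq_square mult.assoc)

lemma cov_self_le_mean_square: "cov p x x \<le> (\<Sum>i\<in>UNIV. p i * (x i)\<^sup>2)"
  by (simp add: cov_def power2_eq_square mult.assoc)

text \<open>
  This is Gershgorin's bound for \<open>diag p - p p\<^sup>T\<close>, whose \<open>i\<close>-th row has absolute sum
  \<open>2 p\<^sub>i (1 - p\<^sub>i) \<le> 1/2\<close>. In terms of pairwise differences, use
  \<open>(a - b)\<^sup>2 \<le> 2 a\<^sup>2 + 2 b\<^sup>2\<close> off the diagonal.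
\<close>

lemma cov_self_le_half:
  assumes p: "weights p"
  shows "cov p x x \<le> (\<Sum>i\<in>UNIV. (x i)\<^sup>2) / 2"
proof -
  \<comment> \<open>The subtracted term makes the bound \<open>0\<close> on the diagonal. Without it the factor
    \<open>1 - p i\<close> is lost and the constant becomes \<open>2\<close> instead of \<open>1/2\<close>.\<close>
  have pair: "p i * p j * (x i - x j)\<^sup>2
      \<le> 2 * (p i * (x i)\<^sup>2 * p j) + 2 * (p i * (p j * (x j)\<^sup>2))
        - (if j = i then 4 * ((p i)\<^sup>2 * (x i)\<^sup>2) else 0)" for i j
  proof (cases "j = i")
    case False
    have "(x i - x j)\<^sup>2 \<le> 2 * (x i)\<^sup>2 + 2 * (x j)\<^sup>2"
      using sum_power2_ge_zero[of "x i + x j" 0] by (simp add: power2_eq_square algebra_simps)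
    then have "p i * p j * (x i - x j)\<^sup>2 \<le> p i * p j * (2 * (x i)\<^sup>2 + 2 * (x j)\<^sup>2)"
      using p by (intro mult_left_mono) auto
    with False show ?thesis by (simp add: algebra_simps)
  qed (simp add: power2_eq_square)
  have "2 * cov p x x = (\<Sum>i\<in>UNIV. \<Sum>j\<in>UNIV. p i * p j * (x i - x j)\<^sup>2)"
    using p by (simp add: cov_eq_pairwise_differences)
  also have "\<dots> \<le> (\<Sum>i\<in>UNIV. \<Sum>j\<in>UNIV. 2 * (p i * (x i)\<^sup>2 * p j) + 2 * (p i * (p j * (x j)\<^sup>2))
        - (if j = i then 4 * ((p i)\<^sup>2 * (x i)\<^sup>2) else 0))"
    by (intro sum_mono pair)
  also have "\<dots> = 4 * (\<Sum>i\<in>UNIV. p i * (x i)\<^sup>2) - 4 * (\<Sum>i\<in>UNIV. (p i)\<^sup>2 * (x i)\<^sup>2)"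
    using p by (simp add: sum.distrib sum_subtractf flip: sum_distrib_left sum_distrib_right)
  also have "\<dots> = (\<Sum>i\<in>UNIV. 4 * (p i * (1 - p i)) * (x i)\<^sup>2)"
    by (simp add: sum_distrib_left power2_eq_square algebra_simps flip: sum_subtractf)
  also have "\<dots> \<le> (\<Sum>i\<in>UNIV. 1 * (x i)\<^sup>2)"
  proof (intro sum_mono mult_right_mono)
    fix i
    show "4 * (p i * (1 - p i)) \<le> 1"
      using zero_le_power2[of "1 - 2 * p i"] by (simp add: power2_eq_square algebra_simps)
  qed simp
  finally show ?thesis by simp
qed

text \<open>
  Replacing each product \<open>p i * p j\<close> by \<open>q\<^sup>2\<close> leaves the unweighted sum of the squared
  pairwise differences, and for a vector with sum zero this is twice the dimension times the
  squared norm.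
\<close>

lemma cov_self_ge_if_sum_zero:
  fixes p :: "'d::finite \<Rightarrow> real"
  assumes p: "(\<Sum>i\<in>UNIV. p i) = 1" and q: "0 \<le> q" "\<And>i. q \<le> p i"
    and x: "(\<Sum>i\<in>UNIV. x i) = 0"
  shows "real CARD('d) * q\<^sup>2 * (\<Sum>i\<in>UNIV. (x i)\<^sup>2) \<le> cov p x x"
proof -
  have "2 * (real CARD('d) * (\<Sum>i\<in>UNIV. (x i)\<^sup>2))
      = (\<Sum>i\<in>UNIV. \<Sum>j\<in>UNIV. (x i)\<^sup>2 + (x j)\<^sup>2 - 2 * (x i * x j))"
    using x by (simp add: sum.distrib sum_subtractf flip: sum_distrib_left sum_distrib_right)
  also have "\<dots> = (\<Sum>i\<in>UNIV. \<Sum>j\<in>UNIV. (x i - x j)\<^sup>2)"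
    by (intro sum.cong refl) (simp add: power2_eq_square algebra_simps)
  finally have "2 * (real CARD('d) * q\<^sup>2 * (\<Sum>i\<in>UNIV. (x i)\<^sup>2))
      = (\<Sum>i\<in>UNIV. \<Sum>j\<in>UNIV. q * q * (x i - x j)\<^sup>2)"
    by (simp add: power2_eq_square mult_ac flip: sum_distrib_left)
  also have "\<dots> \<le> (\<Sum>i\<in>UNIV. \<Sum>j\<in>UNIV. p i * p j * (x i - x j)\<^sup>2)"
    using q by (intro sum_mono mult_right_mono mult_mono) (auto intro: order_trans)
  also have "\<dots> = 2 * cov p x x"
    using p by (simp add: cov_eq_pairwise_differences)
  finally show ?thesis by simp
qed

section \<open>Derivatives of softmax and log-sum-exp\<close>

definition softmax :: "('d::finite \<Rightarrow> real) \<Rightarrow> ('d \<Rightarrow> real) \<Rightarrow> 'd \<Rightarrow> real" where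
  "softmax a u i = a i * exp (u i) / (\<Sum>l\<in>UNIV. a l * exp (u l))"

lemma sum_weights_exp_pos:
  assumes "weights a"
  shows "0 < (\<Sum>l\<in>UNIV. a l * exp (u l))"
proof -
  obtain l where "a l \<noteq> 0"
    using assms by (metis sum.neutral zero_neq_one)
  then have "0 < a l" using assms by (metis order_le_less)
  then show ?thesis using assms by (intro sum_pos2[of _ l]) auto
qed

lemma weights_softmax:
  assumes "weights a"
  shows "weights (softmax a u)"
  using assms sum_weights_exp_pos[OF assms, of u]
  by (auto simp: softmax_def simp flip: sum_divide_distrib)

lemma has_derivative_ln_sum_exp:
  fixes f :: "'d::finite \<Rightarrow> 'x::real_normed_vector \<Rightarrow> real"
  assumes a: "weights a" and f: "\<And>i. (f i has_derivative f' i) (at z)"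
  shows "((\<lambda>z. ln (\<Sum>i\<in>UNIV. a i * exp (f i z))) has_derivative
          (\<lambda>h. \<Sum>i\<in>UNIV. softmax a (\<lambda>l. f l z) i * f' i h)) (at z)"
  using sum_weights_exp_pos[OF a, of "\<lambda>l. f l z"]
  by (auto intro!: derivative_eq_intros f sum.cong ext
      simp: softmax_def sum_distrib_right sum_distrib_left sum_divide_distrib field_simps)

lemma has_derivative_softmax:
  fixes f :: "'d::finite \<Rightarrow> 'x::real_normed_vector \<Rightarrow> real"
  assumes a: "weights a" and f: "\<And>i. (f i has_derivative f' i) (at z)"
  shows "((\<lambda>z. softmax a (\<lambda>l. f l z) i) has_derivative
          (\<lambda>h. softmax a (\<lambda>l. f l z) i * (f' i h - (\<Sum>l\<in>UNIV. softmax a (\<lambda>l. f l z) l * f' l h))))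
         (at z)"
proof -
  \<comment> \<open>Writing softmax as the exponential of a difference makes its derivative a consequence of
    that of log-sum-exp and avoids the quotient rule.\<close>
  let ?lse = "\<lambda>z. ln (\<Sum>l\<in>UNIV. a l * exp (f l z))"
  have eq: "softmax a u i = a i * exp (u i - ln (\<Sum>l\<in>UNIV. a l * exp (u l)))" for u
    using sum_weights_exp_pos[OF a, of u] by (simp add: softmax_def exp_diff)
  have "((\<lambda>z. f i z - ?lse z) has_derivative
      (\<lambda>h. f' i h - (\<Sum>l\<in>UNIV. softmax a (\<lambda>l. f l z) l * f' l h))) (at z)"
    by (intro has_derivative_diff f has_derivative_ln_sum_exp[OF a])
  from has_derivative_mult_right[OF has_derivative_exp[OF this], of "a i"]
  show ?thesis
    by (simp add: eq mult_ac)
qed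

section \<open>Gradients, Jacobians and eigenvalues\<close>

lemma sum_UNIV_prod:
  "(\<Sum>c\<in>UNIV. f c) = (\<Sum>k\<in>UNIV. \<Sum>j\<in>UNIV. f (k, j))"
  by (simp add: sum.cartesian_product)

lemma has_derivative_vec_lambda:
  assumes "\<And>i. ((\<lambda>z. f z i) has_derivative (\<lambda>h. D h i)) (at z)"
  shows "((\<lambda>z. (\<chi> i. f z i) :: real ^ 'd) has_derivative (\<lambda>h. \<chi> i. D h i)) (at z)"
  using assms
  by (subst has_derivative_componentwise_within) (auto simp: Basis_vec_def inner_axis)

lemma has_derivative_vec_nth: "((\<lambda>z :: real ^ 'd. z $ i) has_derivative (\<lambda>h. h $ i)) F"
  by (rule bounded_linear_imp_has_derivative[OF bounded_linear_vec_nth])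

lemma gradient_eq:
  assumes "(f has_derivative D) (at z)"
  shows "gradient f z = (\<chi> c. D (axis c 1))"
  using frechet_derivative_at[OF assms] by (simp add: gradient_def)

lemma jacobian_mult:
  fixes f :: "real ^ 'd \<Rightarrow> real ^ 'e"
  assumes "(f has_derivative D) (at z)"
  shows "jacobian f (at z) *v h = D h"
  using has_derivative_unique[OF assms] jacobian_works[of f "at z"] assms
  by (metis differentiableI)

text \<open>
  Eigenvectors of distinct eigenvalues are orthogonal, so choosing one for each eigenvalue
  gives an independent set.
\<close>

lemma finite_eigenvalues_symmetric:
  fixes A :: "real ^ 'd ^ 'd"
  assumes sym: "\<And>x y. y \<bullet> (A *v x) = x \<bullet> (A *v y)"
  shows "finite (eigenvalues A)"
proof -
  obtain e where e: "\<And>c. c \<in> eigenvalues A \<Longrightarrow> e c \<noteq> 0 \<and> A *v e c = c *\<^sub>R e c"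
    using bchoice[of "eigenvalues A" "\<lambda>c x. x \<noteq> 0 \<and> A *v x = c *\<^sub>R x"]
    by (auto simp: eigenvalues_def)
  have orth: "e c \<bullet> e d = 0" if "c \<in> eigenvalues A" "d \<in> eigenvalues A" "c \<noteq> d" for c d
    using sym[of "e c" "e d"] e[OF that(1)] e[OF that(2)] that(3) by (simp add: inner_commute)
  have inj: "inj_on e (eigenvalues A)"
    by (rule inj_onI) (metis e orth inner_eq_zero_iff)
  have "pairwise orthogonal (e ` eigenvalues A)"
    using orth by (auto simp: pairwise_def orthogonal_def)
  then have "independent (e ` eigenvalues A)"
    using e by (intro pairwise_orthogonal_independent) auto
  then have "finite (e ` eigenvalues A)"
    by (rule independent_imp_finite)
  then show ?thesis
    using inj by (rule finite_imageD)
qed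

section \<open>The Hessian as a sum of covariances\<close>

locale entropic_barycenter =
  fixes \<eta> \<tau> :: real
    and w :: "'k::finite \<Rightarrow> real"
    and \<mu> :: "'k \<Rightarrow> real ^ 'm::finite"
    and C :: "'k \<Rightarrow> real ^ 'm ^ 'n::finite"
    and \<pi> :: "real ^ 'n"
  assumes eta_pos: "\<eta> > 0" and tau_pos: "\<tau> > 0"
    and w: "weights w"
    and mu: "\<And>k. weights (\<lambda>j. \<mu> k $ j)"
    and pi: "weights (\<lambda>i. \<pi> $ i)"
begin

abbreviation P :: "real ^ ('k \<times> 'm) \<Rightarrow> 'k \<Rightarrow> 'n \<Rightarrow> 'm \<Rightarrow> real" where
  "P \<beta> k i j \<equiv> Pmat \<eta> (\<mu> k) (C k) (blk \<beta> k) $ i $ j"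

abbreviation v :: "real ^ ('k \<times> 'm) \<Rightarrow> 'n \<Rightarrow> real" where
  "v \<beta> i \<equiv> vvec \<eta> \<tau> w \<mu> C \<pi> \<beta> $ i"

text \<open>
  \<open>mix \<beta> x\<close> is \<open>\<Sum>\<^sub>k w\<^sub>k P\<^sub>k x\<^sub>k\<close>, the negative of the derivative of
  \<open>\<Phi>\<close> at \<open>\<beta>\<close> in the direction \<open>x\<close>.
\<close>

definition mix :: "real ^ ('k \<times> 'm) \<Rightarrow> real ^ ('k \<times> 'm) \<Rightarrow> 'n \<Rightarrow> real" where
  "mix \<beta> x i = (\<Sum>k\<in>UNIV. w k * (\<Sum>j\<in>UNIV. P \<beta> k i j * x $ (k, j)))"

text \<open>
  The block formula for \<open>\<nabla>\<^sup>2 \<L>\<close>, regrouped as a bilinear form. The matrix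
  \<open>P\<^sub>k\<^sup>T diag(v) P\<^sub>r - \<gamma>\<^sub>k \<gamma>\<^sub>r\<^sup>T\<close> is a covariance of row averages under \<open>v\<close>, and
  \<open>diag(\<gamma>\<^sub>k) - P\<^sub>k\<^sup>T diag(v) P\<^sub>k\<close> is the \<open>v\<close>-average of the covariances under the rows
  of \<open>P\<^sub>k\<close>.
\<close>

definition hess_form ::
  "real ^ ('k \<times> 'm) \<Rightarrow> real ^ ('k \<times> 'm) \<Rightarrow> real ^ ('k \<times> 'm) \<Rightarrow> real" where
  "hess_form \<beta> x y = cov (v \<beta>) (mix \<beta> x) (mix \<beta> y) / \<tau>
     + (\<Sum>k\<in>UNIV. w k / \<eta> * (\<Sum>i\<in>UNIV. v \<beta> i * cov (P \<beta> k i) (\<lambda>j. x $ (k, j)) (\<lambda>j. y $ (k, j))))"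

lemma P_eq_softmax:
  "P \<beta> k i = softmax (\<lambda>j. \<mu> k $ j) (\<lambda>j. (\<beta> $ (k, j) - C k $ i $ j) / \<eta>)"
  by (rule ext) (simp add: Pmat_def softmax_def blk_def)

lemma v_eq_softmax:
  "v \<beta> = softmax (\<lambda>i. \<pi> $ i) (\<lambda>i. - Phi \<eta> w \<mu> C \<beta> $ i / \<tau>)"
  by (rule ext) (simp add: vvec_def softmax_def)

lemma weights_P: "weights (P \<beta> k i)"
  unfolding P_eq_softmax by (rule weights_softmax[OF mu])

lemma weights_v: "weights (v \<beta>)"
  unfolding v_eq_softmax by (rule weights_softmax[OF pi])

lemma has_derivative_score:
  "((\<lambda>\<beta>. (\<beta> $ (k, j) - C k $ i $ j) / \<eta>) has_derivative (\<lambda>h. h $ (k, j) / \<eta>)) (at \<beta>)"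
  using eta_pos by (auto intro!: derivative_eq_intros has_derivative_vec_nth)

lemma has_derivative_P:
  "((\<lambda>\<beta>. P \<beta> k i j) has_derivative
     (\<lambda>h. P \<beta> k i j * (h $ (k, j) - (\<Sum>l\<in>UNIV. P \<beta> k i l * h $ (k, l))) / \<eta>)) (at \<beta>)"
  using has_derivative_softmax[OF mu has_derivative_score, where i = j] eta_pos
  unfolding P_eq_softmax
  by (simp add: diff_divide_distrib right_diff_distrib flip: sum_divide_distrib)

lemma has_derivative_Phi:
  "((\<lambda>\<beta>. Phi \<eta> w \<mu> C \<beta> $ i) has_derivative (\<lambda>h. - mix \<beta> h i)) (at \<beta>)"
proof -
  have eq: "Phi \<eta> w \<mu> C \<beta> $ i = (\<Sum>k\<in>UNIV. w k * (- \<eta> *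
      ln (\<Sum>j\<in>UNIV. \<mu> k $ j * exp ((\<beta> $ (k, j) - C k $ i $ j) / \<eta>))))" for \<beta>
    by (simp add: Phi_def alpha_def blk_def)
  have "((\<lambda>\<beta>. Phi \<eta> w \<mu> C \<beta> $ i) has_derivative
      (\<lambda>h. \<Sum>k\<in>UNIV. w k * (- \<eta> * (\<Sum>j\<in>UNIV. P \<beta> k i j * (h $ (k, j) / \<eta>))))) (at \<beta>)"
    unfolding eq P_eq_softmax
    by (intro has_derivative_sum has_derivative_mult_right has_derivative_ln_sum_exp mu
        has_derivative_score)
  then show ?thesis
    using eta_pos by (simp add: mix_def sum_negf flip: sum_divide_distrib)
qed

lemma has_derivative_potential:
  "((\<lambda>\<beta>. - Phi \<eta> w \<mu> C \<beta> $ i / \<tau>) has_derivative (\<lambda>h. mix \<beta> h i / \<tau>)) (at \<beta>)"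
  using tau_pos by (auto intro!: derivative_eq_intros has_derivative_Phi)

lemma has_derivative_v:
  "((\<lambda>\<beta>. v \<beta> i) has_derivative
     (\<lambda>h. v \<beta> i * (mix \<beta> h i - (\<Sum>l\<in>UNIV. v \<beta> l * mix \<beta> h l)) / \<tau>)) (at \<beta>)"
  using has_derivative_softmax[OF pi has_derivative_potential, where i = i]
  unfolding v_eq_softmax
  by (simp add: diff_divide_distrib right_diff_distrib flip: sum_divide_distrib)

lemma has_derivative_objective:
  "(objective \<eta> \<tau> w \<mu> C \<pi> has_derivative
     (\<lambda>h. (\<Sum>i\<in>UNIV. v \<beta> i * mix \<beta> h i) - (\<Sum>k\<in>UNIV. w k * (\<Sum>j\<in>UNIV. \<mu> k $ j * h $ (k, j))))) (at \<beta>)"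
proof -
  have eq: "objective \<eta> \<tau> w \<mu> C \<pi> = (\<lambda>\<beta>.
      \<tau> * ln (\<Sum>i\<in>UNIV. \<pi> $ i * exp (- Phi \<eta> w \<mu> C \<beta> $ i / \<tau>))
      - (\<Sum>k\<in>UNIV. w k * (\<Sum>j\<in>UNIV. \<mu> k $ j * \<beta> $ (k, j))))"
    by (rule ext) (simp add: objective_def inner_vec_def blk_def mult.commute)
  have "(objective \<eta> \<tau> w \<mu> C \<pi> has_derivative
     (\<lambda>h. \<tau> * (\<Sum>i\<in>UNIV. v \<beta> i * (mix \<beta> h i / \<tau>))
        - (\<Sum>k\<in>UNIV. w k * (\<Sum>j\<in>UNIV. \<mu> k $ j * h $ (k, j))))) (at \<beta>)"
    unfolding eq v_eq_softmax
    by (intro has_derivative_diff has_derivative_sum has_derivative_mult_right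
        has_derivative_ln_sum_exp pi has_derivative_potential has_derivative_vec_nth)
  then show ?thesis
    using tau_pos by (simp flip: sum_divide_distrib)
qed

lemma sum_blocks_axis:
  fixes F :: "'k \<Rightarrow> 'm \<Rightarrow> real"
  shows "(\<Sum>k\<in>UNIV. w k * (\<Sum>j\<in>UNIV. F k j * axis c 1 $ (k, j))) = w (fst c) * F (fst c) (snd c)"
proof -
  have "(\<Sum>k\<in>UNIV. w k * (\<Sum>j\<in>UNIV. F k j * axis c 1 $ (k, j)))
      = (\<Sum>d\<in>UNIV. (w (fst d) * F (fst d) (snd d)) * axis c 1 $ d)"
    by (simp add: sum_UNIV_prod sum_distrib_left mult.assoc)
  also have "\<dots> = w (fst c) * F (fst c) (snd c)"
    by (simp add: axis_def if_distrib cong: if_cong)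
  finally show ?thesis .
qed

lemma mix_axis: "mix \<beta> (axis c 1) i = w (fst c) * P \<beta> (fst c) i (snd c)"
  by (simp add: mix_def sum_blocks_axis)

lemma gradient_objective:
  "gradient (objective \<eta> \<tau> w \<mu> C \<pi>) \<beta>
     = (\<chi> c. w (fst c) * ((\<Sum>i\<in>UNIV. v \<beta> i * P \<beta> (fst c) i (snd c)) - \<mu> (fst c) $ snd c))"
  by (subst gradient_eq[OF has_derivative_objective])
     (simp add: mix_axis sum_blocks_axis, simp add: sum_distrib_left right_diff_distrib mult_ac)

text \<open>
  The product rule applied to each entry \<open>w\<^sub>k (\<Sum>\<^sub>i v\<^sub>i [P\<^sub>k]\<^sub>i\<^sub>j - [\<mu>\<^sub>k]\<^sub>j)\<close> of the
  gradient yields one covariance from the derivative of \<open>v\<close> and one from the derivative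
  of \<open>P\<^sub>k\<close>.
\<close>

lemma inner_hessian_mult:
  "y \<bullet> (hessian (objective \<eta> \<tau> w \<mu> C \<pi>) \<beta> *v x) = hess_form \<beta> x y"
proof -
  define dv where "dv i = v \<beta> i * (mix \<beta> x i - (\<Sum>l\<in>UNIV. v \<beta> l * mix \<beta> x l)) / \<tau>" for i
  define dP where "dP k i j = P \<beta> k i j * (x $ (k, j) - (\<Sum>l\<in>UNIV. P \<beta> k i l * x $ (k, l))) / \<eta>"
    for k i j
  have "((\<lambda>\<beta>. \<chi> c. w (fst c) * ((\<Sum>i\<in>UNIV. v \<beta> i * P \<beta> (fst c) i (snd c)) - \<mu> (fst c) $ snd c))
      has_derivative (\<lambda>x. \<chi> c. w (fst c) * ((\<Sum>i\<in>UNIV.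
          v \<beta> i * (P \<beta> (fst c) i (snd c)
             * (x $ (fst c, snd c) - (\<Sum>l\<in>UNIV. P \<beta> (fst c) i l * x $ (fst c, l))) / \<eta>)
        + v \<beta> i * (mix \<beta> x i - (\<Sum>l\<in>UNIV. v \<beta> l * mix \<beta> x l)) / \<tau> * P \<beta> (fst c) i (snd c)) - 0))) (at \<beta>)"
    by (intro has_derivative_vec_lambda has_derivative_mult_right has_derivative_diff
        has_derivative_const has_derivative_sum has_derivative_mult has_derivative_v has_derivative_P)
  then have "hessian (objective \<eta> \<tau> w \<mu> C \<pi>) \<beta> *v x =
      (\<chi> c. w (fst c) * (\<Sum>i\<in>UNIV. v \<beta> i * dP (fst c) i (snd c) + dv i * P \<beta> (fst c) i (snd c)))"
    unfolding hessian_def gradient_objective[abs_def] dv_def dP_def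
    by (subst jacobian_mult) auto
  then have "y \<bullet> (hessian (objective \<eta> \<tau> w \<mu> C \<pi>) \<beta> *v x) = (\<Sum>k\<in>UNIV. \<Sum>j\<in>UNIV.
      y $ (k, j) * (w k * (\<Sum>i\<in>UNIV. v \<beta> i * dP k i j + dv i * P \<beta> k i j)))"
    by (simp add: inner_vec_def sum_UNIV_prod)
  also have "\<dots> = (\<Sum>k\<in>UNIV. \<Sum>j\<in>UNIV. \<Sum>i\<in>UNIV. dv i * (w k * (P \<beta> k i j * y $ (k, j))))
      + (\<Sum>k\<in>UNIV. \<Sum>j\<in>UNIV. \<Sum>i\<in>UNIV. w k * (v \<beta> i * (dP k i j * y $ (k, j))))"
    by (simp add: sum_distrib_left sum.distrib[symmetric] algebra_simps)
  also have "(\<Sum>k\<in>UNIV. \<Sum>j\<in>UNIV. \<Sum>i\<in>UNIV. dv i * (w k * (P \<beta> k i j * y $ (k, j))))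
      = (\<Sum>k\<in>UNIV. \<Sum>i\<in>UNIV. \<Sum>j\<in>UNIV. dv i * (w k * (P \<beta> k i j * y $ (k, j))))"
    by (intro sum.cong refl sum.swap)
  also have "\<dots> = (\<Sum>i\<in>UNIV. \<Sum>k\<in>UNIV. \<Sum>j\<in>UNIV. dv i * (w k * (P \<beta> k i j * y $ (k, j))))"
    by (rule sum.swap)
  also have "\<dots> = (\<Sum>i\<in>UNIV. dv i * mix \<beta> y i)"
    by (simp add: mix_def sum_distrib_left)
  also have "\<dots> = cov (v \<beta>) (mix \<beta> x) (mix \<beta> y) / \<tau>"
    by (simp add: dv_def cov_eq_centred sum_divide_distrib)
  also have "(\<Sum>k\<in>UNIV. \<Sum>j\<in>UNIV. \<Sum>i\<in>UNIV. w k * (v \<beta> i * (dP k i j * y $ (k, j))))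
      = (\<Sum>k\<in>UNIV. \<Sum>i\<in>UNIV. \<Sum>j\<in>UNIV. w k * (v \<beta> i * (dP k i j * y $ (k, j))))"
    by (intro sum.cong refl sum.swap)
  also have "\<dots> = (\<Sum>k\<in>UNIV. w k / \<eta> * (\<Sum>i\<in>UNIV. v \<beta> i
      * cov (P \<beta> k i) (\<lambda>j. x $ (k, j)) (\<lambda>j. y $ (k, j))))"
    by (simp add: dP_def cov_eq_centred sum_distrib_left sum_divide_distrib mult_ac)
  finally show ?thesis
    by (simp add: hess_form_def)
qed

section \<open>Bounds on the Hessian form\<close>

lemma hess_form_commute: "hess_form \<beta> x y = hess_form \<beta> y x"
  by (simp add: hess_form_def cov_commute)

text \<open>
  On a block-constant \<open>y\<close> the row averages \<open>P\<^sub>k y\<^sub>k\<close> do not depend on the row, since the rows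
  sum to one. Hence every covariance in the form is taken against a constant.
\<close>

lemma hess_form_block_constant:
  assumes "\<And>k j. y $ (k, j) = c k"
  shows "hess_form \<beta> x y = 0"
proof -
  have "mix \<beta> y = (\<lambda>_. \<Sum>k\<in>UNIV. w k * c k)"
    using weights_P by (simp add: fun_eq_iff mix_def assms flip: sum_distrib_right)
  then show ?thesis
    using weights_P weights_v by (simp add: hess_form_def assms cov_const_right)
qed

lemma norm_sq_blocks: "(norm x)\<^sup>2 = (\<Sum>k\<in>UNIV. \<Sum>j\<in>UNIV. (x $ (k, j))\<^sup>2)"
  for x :: "real ^ ('k \<times> 'm)"
  unfolding power2_norm_eq_inner inner_vec_def sum_UNIV_prod by (simp add: power2_eq_square)

lemma mix_sq_le: "(mix \<beta> x i)\<^sup>2 \<le> (\<Sum>k\<in>UNIV. w k * (\<Sum>j\<in>UNIV. P \<beta> k i j * (x $ (k, j))\<^sup>2))"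
proof -
  have "(mix \<beta> x i)\<^sup>2 \<le> (\<Sum>k\<in>UNIV. w k * (\<Sum>j\<in>UNIV. P \<beta> k i j * x $ (k, j))\<^sup>2)"
    unfolding mix_def by (rule square_mean_le_mean_square[OF w])
  also have "\<dots> \<le> (\<Sum>k\<in>UNIV. w k * (\<Sum>j\<in>UNIV. P \<beta> k i j * (x $ (k, j))\<^sup>2))"
    using w by (intro sum_mono mult_left_mono square_mean_le_mean_square[OF weights_P]) auto
  finally show ?thesis .
qed

lemma hess_form_le: "hess_form \<beta> x x \<le> Max (range w) * (1 / (2 * \<eta>) + 1 / \<tau>) * (norm x)\<^sup>2"
proof -
  let ?N = "\<lambda>k. \<Sum>j\<in>UNIV. (x $ (k, j))\<^sup>2"
  have N: "(\<Sum>k\<in>UNIV. w k * ?N k) \<le> Max (range w) * (norm x)\<^sup>2"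
    unfolding norm_sq_blocks sum_distrib_left
    by (intro sum_mono mult_right_mono) auto
  have P1: "P \<beta> k i j \<le> 1" for k i j
    using weights_P[of k \<beta> i] member_le_sum[of j UNIV "P \<beta> k i"] by simp
  have "cov (v \<beta>) (mix \<beta> x) (mix \<beta> x) \<le> (\<Sum>i\<in>UNIV. v \<beta> i * (mix \<beta> x i)\<^sup>2)"
    by (rule cov_self_le_mean_square)
  also have "\<dots> \<le> (\<Sum>k\<in>UNIV. w k * ?N k)"
  proof (rule weighted_average_le[OF weights_v])
    fix i
    have "(\<Sum>k\<in>UNIV. w k * (\<Sum>j\<in>UNIV. P \<beta> k i j * (x $ (k, j))\<^sup>2)) \<le> (\<Sum>k\<in>UNIV. w k * (\<Sum>j\<in>UNIV. 1 * (x $ (k, j))\<^sup>2))"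
      using w by (intro sum_mono mult_left_mono mult_right_mono P1) auto
    then show "(mix \<beta> x i)\<^sup>2 \<le> (\<Sum>k\<in>UNIV. w k * ?N k)"
      using mix_sq_le[of \<beta> x i] by simp
  qed
  also note N
  finally have A: "cov (v \<beta>) (mix \<beta> x) (mix \<beta> x) / \<tau> \<le> Max (range w) * (norm x)\<^sup>2 / \<tau>"
    using tau_pos by (simp add: divide_right_mono)
  have "(\<Sum>k\<in>UNIV. w k / \<eta> * (\<Sum>i\<in>UNIV. v \<beta> i * cov (P \<beta> k i) (\<lambda>j. x $ (k, j)) (\<lambda>j. x $ (k, j))))
      \<le> (\<Sum>k\<in>UNIV. w k / \<eta> * (?N k / 2))"
    using w eta_pos
    by (intro sum_mono mult_left_mono weighted_average_le[OF weights_v] cov_self_le_half[OF weights_P]) auto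
  also have "\<dots> = (\<Sum>k\<in>UNIV. w k * ?N k) / (2 * \<eta>)"
    by (simp add: mult_ac flip: sum_divide_distrib)
  also have "\<dots> \<le> Max (range w) * (norm x)\<^sup>2 / (2 * \<eta>)"
    using N eta_pos by (intro divide_right_mono) auto
  finally show ?thesis
    using A unfolding hess_form_def by (simp add: algebra_simps add_divide_distrib)
qed

text \<open>
  The covariance under \<open>v\<close> and all rows but \<open>i0\<close> are dropped as nonnegative. The weight of the
  remaining row is at least the average \<open>1/n\<close>.
\<close>

lemma hess_form_ge:
  assumes mode: "\<And>i. v \<beta> i \<le> v \<beta> i0"
    and q: "\<And>k. 0 \<le> q k" "\<And>k j. q k \<le> P \<beta> k i0 j"
    and x: "\<And>k. (\<Sum>j\<in>UNIV. x $ (k, j)) = 0"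
  shows "real CARD('m) / (\<eta> * real CARD('n)) * Min (range (\<lambda>k. w k * (q k)\<^sup>2)) * (norm x)\<^sup>2
       \<le> hess_form \<beta> x x"
proof -
  let ?N = "\<lambda>k. \<Sum>j\<in>UNIV. (x $ (k, j))\<^sup>2"
  let ?cov = "\<lambda>k i. cov (P \<beta> k i) (\<lambda>j. x $ (k, j)) (\<lambda>j. x $ (k, j))"
  let ?a = "real CARD('m) / (\<eta> * real CARD('n))"
  have "1 \<le> real CARD('n) * v \<beta> i0"
    using weights_v[of \<beta>] sum_bounded_above[of UNIV "v \<beta>" "v \<beta> i0"] mode by simp
  then have v: "1 / real CARD('n) \<le> v \<beta> i0"
    by (simp add: field_simps)
  have block: "real CARD('m) * (q k)\<^sup>2 * ?N k / real CARD('n) \<le> (\<Sum>i\<in>UNIV. v \<beta> i * ?cov k i)" for k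
  proof -
    have "1 / real CARD('n) * (real CARD('m) * (q k)\<^sup>2 * ?N k) \<le> v \<beta> i0 * ?cov k i0"
      using weights_P[of k \<beta> i0] weights_v[of \<beta>] q x
      by (intro mult_mono v cov_self_ge_if_sum_zero) (auto intro!: sum_nonneg mult_nonneg_nonneg)
    also have "\<dots> \<le> (\<Sum>i\<in>UNIV. v \<beta> i * ?cov k i)"
      using weights_v[of \<beta>] cov_self_nonneg[OF weights_P]
      by (intro member_le_sum) (auto intro!: mult_nonneg_nonneg)
    finally show ?thesis by simp
  qed
  have "?a * Min (range (\<lambda>k. w k * (q k)\<^sup>2)) * (norm x)\<^sup>2
      = (\<Sum>k\<in>UNIV. ?a * Min (range (\<lambda>k. w k * (q k)\<^sup>2)) * ?N k)"
    unfolding norm_sq_blocks by (simp add: sum_distrib_left)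
  also have "\<dots> \<le> (\<Sum>k\<in>UNIV. ?a * (w k * (q k)\<^sup>2) * ?N k)"
    using eta_pos by (intro sum_mono mult_left_mono mult_right_mono sum_nonneg) auto
  also have "\<dots> = (\<Sum>k\<in>UNIV. w k / \<eta> * (real CARD('m) * (q k)\<^sup>2 * ?N k / real CARD('n)))"
    by (simp add: mult_ac)
  also have "\<dots> \<le> (\<Sum>k\<in>UNIV. w k / \<eta> * (\<Sum>i\<in>UNIV. v \<beta> i * ?cov k i))"
    using w eta_pos by (intro sum_mono mult_left_mono block) auto
  also have "\<dots> \<le> hess_form \<beta> x x"
    using cov_self_nonneg[OF weights_v] tau_pos by (simp add: hess_form_def)
  finally show ?thesis .
qed

end

section \<open>Eigenvalue bounds\<close>

theorem proposition3p2:
  fixes \<eta> \<tau> :: real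
    and w :: "'k::finite \<Rightarrow> real"
    and \<mu> :: "'k \<Rightarrow> real ^ 'm::finite"
    and C :: "'k \<Rightarrow> real ^ 'm ^ 'n::finite"
    and \<pi> :: "real ^ 'n"
    and \<beta> :: "real ^ ('k \<times> 'm)"
    and H :: "real ^ ('k \<times> 'm) ^ ('k \<times> 'm)"
    and istar :: 'n
    and p :: "'k \<Rightarrow> real"
  assumes "\<eta> > 0" and "\<tau> > 0"
    and "\<And>k. w k > 0" and "(\<Sum>k\<in>UNIV. w k) = 1"
    and "\<And>k. \<mu> k \<in> prob_simplex"
    and "\<And>k i j. C k $ i $ j \<ge> 0"
    and "\<pi> \<in> prob_simplex"
    and H: "H = hessian (objective \<eta> \<tau> w \<mu> C \<pi>) \<beta>"
    and istar: "is_arg_max (\<lambda>i. vvec \<eta> \<tau> w \<mu> C \<pi> \<beta> $ i) (\<lambda>i. True) istar"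
    and p: "\<And>k. p k = Min (range (\<lambda>j. Pmat \<eta> (\<mu> k) (C k) (blk \<beta> k) $ istar $ j))"
  shows "({c \<in> eigenvalues H. 0 < c} \<noteq> {} \<longrightarrow>
           lambda_min_pos H \<ge>
             real CARD('m) / (\<eta> * real CARD('n)) * Min (range (\<lambda>k. w k * (p k)\<^sup>2)))
       \<and> lambda_max H \<le> Max (range w) * (1 / (2 * \<eta>) + 1 / \<tau>)"
proof -
  interpret entropic_barycenter \<eta> \<tau> w \<mu> C \<pi>
    using assms by unfold_locales (auto simp: prob_simplex_def less_imp_le)
  have form: "y \<bullet> (H *v x) = hess_form \<beta> x y" for x y
    unfolding H by (rule inner_hessian_mult)
  have fin: "finite (eigenvalues H)"
    by (rule finite_eigenvalues_symmetric) (simp add: form hess_form_commute)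
  have kernel: "H *v y = 0" if "\<And>k j. y $ (k, j) = c k" for y c
  proof -
    have "(H *v y) \<bullet> (H *v y) = 0"
      by (simp add: form hess_form_commute[of \<beta> y] hess_form_block_constant[OF that])
    then show ?thesis by simp
  qed
  \<comment> \<open>So the maximum that defines the largest eigenvalue ranges over a nonempty set.\<close>
  have "H *v 1 = 0 *\<^sub>R 1"
    by (simp add: kernel[of 1 "\<lambda>_. 1"])
  then have zero: "0 \<in> eigenvalues H"
    unfolding eigenvalues_def by (metis (mono_tags, lifting) mem_Collect_eq zero_neq_one)

  have upper: "c \<le> Max (range w) * (1 / (2 * \<eta>) + 1 / \<tau>)" if c: "c \<in> eigenvalues H" for c
  proof -
    obtain x where x: "x \<noteq> 0" "H *v x = c *\<^sub>R x"
      using c unfolding eigenvalues_def by blast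
    have "c * (norm x)\<^sup>2 \<le> Max (range w) * (1 / (2 * \<eta>) + 1 / \<tau>) * (norm x)\<^sup>2"
      using hess_form_le[of \<beta> x] form[of x x] x by (simp add: power2_norm_eq_inner)
    with x show ?thesis by simp
  qed

  have lower: "real CARD('m) / (\<eta> * real CARD('n)) * Min (range (\<lambda>k. w k * (p k)\<^sup>2)) \<le> c"
    if c: "c \<in> eigenvalues H" "0 < c" for c
  proof -
    obtain x where x: "x \<noteq> 0" "H *v x = c *\<^sub>R x"
      using c unfolding eigenvalues_def by blast
    \<comment> \<open>By symmetry, \<open>c * (y \<bullet> x) = x \<bullet> H y = 0\<close> for the indicator \<open>y\<close> of block \<open>k\<close>.\<close>
    have sum_zero: "(\<Sum>j\<in>UNIV. x $ (k, j)) = 0" for k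
    proof -
      define y :: "real ^ ('k \<times> 'm)" where "y = (\<chi> d. if fst d = k then 1 else 0)"
      have "c * (y \<bullet> x) = hess_form \<beta> x y"
        using form[of y x] x by simp
      also have "\<dots> = 0"
        by (rule hess_form_block_constant[where c = "\<lambda>l. if l = k then 1 else 0"]) (simp add: y_def)
      finally have "y \<bullet> x = 0" using c by simp
      also have "y \<bullet> x = (\<Sum>l\<in>UNIV. if l = k then \<Sum>j\<in>UNIV. x $ (l, j) else 0)"
        unfolding inner_vec_def sum_UNIV_prod by (rule sum.cong) (auto simp: y_def)
      finally show ?thesis by simp
    qed
    have "real CARD('m) / (\<eta> * real CARD('n)) * Min (range (\<lambda>k. w k * (p k)\<^sup>2)) * (norm x)\<^sup>2
        \<le> hess_form \<beta> x x"
    proof (rule hess_form_ge)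
      show "v \<beta> i \<le> v \<beta> istar" for i
        using istar by (auto simp: is_arg_max_def not_less)
      show "0 \<le> p k" for k
        unfolding p using weights_P by auto
      show "p k \<le> P \<beta> k istar j" for k j
        unfolding p by auto
    qed (rule sum_zero)
    also have "hess_form \<beta> x x = c * (norm x)\<^sup>2"
      using form[of x x] x by (simp add: power2_norm_eq_inner)
    finally show ?thesis
      using x by (simp del: times_divide_eq_left)
  qed

  have "lambda_max H \<le> Max (range w) * (1 / (2 * \<eta>) + 1 / \<tau>)"
    unfolding lambda_max_def using fin zero upper by (intro Max.boundedI) auto
  with fin lower show ?thesis
    by (auto simp: lambda_min_pos_def Min_ge_iff)
qed

end
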